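(* (ZFC) Let $X \subseteq {}^\omega 2$ with $|X| = \mathfrak{c}$. Then $X$ is not $s_0$-shiftable, i.e., there is a $Y \in s_0$ such that $X + Y = {}^\omega 2$.
   Context: ${}^\omega 2$ is the Cantor space, regarded as a group under bitwise addition modulo $2$, denoted $+$; $\mathfrak{c} = 2^{\aleph_0}$. For $X,Y\subseteq {}^\omega 2$ and $t\in{}^\omega 2$, $X+Y=\{x+y: x\in X, y\in Y\}$ and $X+t=\{x+t:x\in X\}$. A set $Y \subseteq {}^\omega 2$ is Marczewski null ($Y \in s_0$) if for every perfect set $P \subseteq {}^\omega 2$ there is a perfect set $Q \subseteq P$ with $Q \cap Y = \emptyset$. For a collection $\mathcal I\subseteq\mathcal P({}^\omega 2)$, a set $X \subseteq {}^\omega 2$ is $\mathcal I$-shiftable if $X + Y \neq {}^\omega 2$ for every $Y \in \mathcal I$. *)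

theory Defs
  imports "HOL-Analysis.Analysis"
begin

type_synonym cantor = "nat \<Rightarrow> bool"

definition cantor_top :: "cantor topology" where
  "cantor_top = product_topology (\<lambda>_. discrete_topology (UNIV :: bool set)) UNIV"

definition cadd :: "cantor \<Rightarrow> cantor \<Rightarrow> cantor" where
  "cadd x y = (\<lambda>n. x n \<noteq> y n)"

definition setsum :: "cantor set \<Rightarrow> cantor set \<Rightarrow> cantor set" where
  "setsum X Y = {cadd x y | x y. x \<in> X \<and> y \<in> Y}"

definition perfect_set :: "cantor set \<Rightarrow> bool" where
  "perfect_set P \<longleftrightarrow> P \<noteq> {} \<and> closedin cantor_top P \<and> cantor_top derived_set_of P = P"

definition marczewski_null :: "cantor set \<Rightarrow> bool" where
  "marczewski_null Y \<longleftrightarrow>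
     (\<forall>P. perfect_set P \<longrightarrow> (\<exists>Q. perfect_set Q \<and> Q \<subseteq> P \<and> Q \<inter> Y = {}))"

definition shiftable :: "cantor set set \<Rightarrow> cantor set \<Rightarrow> bool" where
  "shiftable I X \<longleftrightarrow> (\<forall>Y\<in>I. setsum X Y \<noteq> UNIV)"

end

theory Submission
  imports Defs
begin

text \<open>
  Call a family \<open>\<D>\<close> of perfect sets dense if it is translation invariant and every perfect set
  contains a member. If \<open>X\<close> is not covered by fewer than \<open>\<cc>\<close> members of a dense \<open>\<D>\<close>, enumerate the
  perfect sets as \<open>P\<^sub>b\<close> and the points as \<open>a\<close> in order type \<open>\<cc>\<close>, choose \<open>Q\<^sub>b \<subseteq> P\<^sub>b\<close> in \<open>\<D>\<close> and
  \<open>x\<^sub>a \<in> X\<close> outside \<open>a + Q\<^sub>b\<close> for all \<open>b < a\<close>, and let \<open>Y\<close> consist of the points \<open>a + x\<^sub>a\<close>. Then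
  \<open>X + Y\<close> is everything, and \<open>Q\<^sub>b\<close> meets \<open>Y\<close> in fewer than \<open>\<cc>\<close> points, so that one of \<open>\<cc>\<close> disjoint
  perfect subsets of \<open>Q\<^sub>b\<close> misses \<open>Y\<close>.

  To find \<open>\<D>\<close>, assign to a perfect set \<open>Q\<close> its level, the set of cardinals below \<open>\<cc>\<close> bounding all
  \<open>(z + Q) \<inter> X\<close>. If a single cardinal is in the level of densely many \<open>Q\<close>, these \<open>Q\<close> form \<open>\<D>\<close>.
  Otherwise consider perfect sets \<open>T\<close> that have the same level as all their perfect subsets and
  satisfy that \<open>T \<inter> (z + T)\<close> is finite for \<open>z \<noteq> 0\<close>. Fix one such \<open>T\<^sub>L\<close> for each level \<open>L\<close>; no
  perfect set has translates inside two of them. Let \<open>\<A>\<^sub>L\<close> be a maximal almost disjoint family of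
  \<open>\<cc>\<close> perfect subsets of \<open>T\<^sub>L\<close>, and let \<open>\<D>\<close> consist of the \<open>Q\<close> that have a translate inside a member
  of some \<open>\<A>\<^sub>L\<close>, or all of whose translates meet all \<open>T\<^sub>L\<close> in countable sets. Given \<open>\<lambda> < \<cc>\<close> members
  of \<open>\<D>\<close>, choose \<open>L\<close> not containing \<open>\<lambda>\<close> and an \<open>S \<in> \<A>\<^sub>L\<close> that includes no translate of any of them.
  A translate of \<open>S\<close> contains more than \<open>\<lambda>\<close> points of \<open>X\<close> and meets each of them in a countable set.
  This also works for singular \<open>\<cc>\<close>.
\<close>

unbundle cardinal_syntax

section \<open>Cylinders and the topology of Cantor space\<close>

definition cyl :: "cantor \<Rightarrow> nat \<Rightarrow> cantor set" where
  "cyl x n = {y. \<forall>i<n. y i = x i}"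

lemma cyl_self [simp]: "x \<in> cyl x n"
  by (simp add: cyl_def)

lemma cyl_mono: "m \<le> n \<Longrightarrow> cyl x n \<subseteq> cyl x m"
  by (auto simp: cyl_def)

lemma cyl_eq: "y \<in> cyl x n \<Longrightarrow> cyl y n = cyl x n"
  by (auto simp: cyl_def)

lemma cyl_sym: "y \<in> cyl x n \<longleftrightarrow> x \<in> cyl y n"
  by (auto simp: cyl_def)

lemma cyl_separates:
  assumes "x \<noteq> y" obtains n where "y \<notin> cyl x n"
proof -
  obtain i where "x i \<noteq> y i" using assms by auto
  then have "y \<notin> cyl x (Suc i)" by (auto simp: cyl_def)
  then show ?thesis using that by blast
qed

lemma countable_cyls: "countable {cyl x n | x n. True}"
proof -
  have "{cyl x n | x n. True} \<subseteq> range (\<lambda>s. {y. \<forall>i<length s. y i = s ! i})"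
  proof clarify
    fix x n
    have "cyl x n = (\<lambda>s. {y. \<forall>i<length s. y i = s ! i}) (map x [0..<n])"
      by (auto simp: cyl_def)
    then show "cyl x n \<in> range (\<lambda>s. {y. \<forall>i<length s. y i = s ! i})"
      by blast
  qed
  then show ?thesis by (rule countable_subset) auto
qed

lemma topspace_cantor_top [simp]: "topspace cantor_top = UNIV"
  by (simp add: cantor_top_def)

lemma openin_cantor_top_cyl: "openin cantor_top (cyl x n)"
proof -
  have "openin cantor_top (\<Pi>\<^sub>E i\<in>UNIV. if i < n then {x i} else UNIV)"
    unfolding cantor_top_def
    by (rule product_topology_basis) auto
  moreover have "(\<Pi>\<^sub>E i\<in>UNIV. if i < n then {x i} else UNIV) = cyl x n"
    by (auto simp: cyl_def PiE_iff extensional_def split: if_splits)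
  ultimately show ?thesis by simp
qed

lemma openin_cantor_top_iff:
  "openin cantor_top U \<longleftrightarrow> (\<forall>x\<in>U. \<exists>n. cyl x n \<subseteq> U)"
proof
  assume U: "openin cantor_top U"
  show "\<forall>x\<in>U. \<exists>n. cyl x n \<subseteq> U"
  proof
    fix x assume "x \<in> U"
    then obtain V where V: "finite {i. V i \<noteq> UNIV}" "x \<in> Pi\<^sub>E UNIV V" "Pi\<^sub>E UNIV V \<subseteq> U"
      using U unfolding cantor_top_def openin_product_topology_alt by force
    obtain n where n: "\<forall>i\<in>{i. V i \<noteq> UNIV}. i < n"
      using V(1) finite_nat_set_iff_bounded by blast
    have "cyl x n \<subseteq> Pi\<^sub>E UNIV V"
    proof
      fix y assume y: "y \<in> cyl x n"
      have "y i \<in> V i" for i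
      proof (cases "V i = UNIV")
        case False
        then have "y i = x i" using n y by (auto simp: cyl_def)
        then show ?thesis using V(2) by (simp add: PiE_iff)
      qed simp
      then show "y \<in> Pi\<^sub>E UNIV V" by (simp add: PiE_iff)
    qed
    then show "\<exists>n. cyl x n \<subseteq> U" using V(3) by blast
  qed
next
  assume *: "\<forall>x\<in>U. \<exists>n. cyl x n \<subseteq> U"
  show "openin cantor_top U"
  proof (subst openin_subopen, intro ballI)
    fix x assume "x \<in> U"
    then obtain n where "cyl x n \<subseteq> U" using * by blast
    then show "\<exists>T. openin cantor_top T \<and> x \<in> T \<and> T \<subseteq> U"
      by (intro exI[of _ "cyl x n"]) (simp add: openin_cantor_top_cyl)
  qed
qed

lemma closedin_cantor_top_iff:
  "closedin cantor_top C \<longleftrightarrow> (\<forall>x. (\<forall>n. cyl x n \<inter> C \<noteq> {}) \<longrightarrow> x \<in> C)"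
proof -
  have "cyl x n \<subseteq> UNIV - C \<longleftrightarrow> cyl x n \<inter> C = {}" for x n
    by blast
  then have "closedin cantor_top C \<longleftrightarrow> (\<forall>x\<in>UNIV - C. \<exists>n. cyl x n \<inter> C = {})"
    by (simp add: closedin_def openin_cantor_top_iff)
  then show ?thesis by blast
qed

text \<open>Closedness already puts the limit points of \<open>P\<close> into \<open>P\<close>; what
  remains is the absence of isolated points, which can be tested on cylinders.\<close>

lemma perfect_set_iff:
  "perfect_set P \<longleftrightarrow> P \<noteq> {} \<and> closedin cantor_top P \<and> (\<forall>x\<in>P. \<forall>n. \<exists>y\<in>P. y \<noteq> x \<and> y \<in> cyl x n)"
proof -
  have der: "x \<in> cantor_top derived_set_of P \<longleftrightarrow> (\<forall>n. \<exists>y\<in>P. y \<noteq> x \<and> y \<in> cyl x n)" for x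
  proof
    assume "x \<in> cantor_top derived_set_of P"
    then show "\<forall>n. \<exists>y\<in>P. y \<noteq> x \<and> y \<in> cyl x n"
      unfolding in_derived_set_of using openin_cantor_top_cyl cyl_self by meson
  next
    assume *: "\<forall>n. \<exists>y\<in>P. y \<noteq> x \<and> y \<in> cyl x n"
    show "x \<in> cantor_top derived_set_of P"
      unfolding in_derived_set_of
    proof (intro conjI allI impI)
      fix U assume "x \<in> U \<and> openin cantor_top U"
      then obtain n where "cyl x n \<subseteq> U" unfolding openin_cantor_top_iff by blast
      then show "\<exists>y. y \<noteq> x \<and> y \<in> P \<and> y \<in> U" using * by (meson subsetD)
    qed simp
  qed
  show ?thesis
  proof (cases "closedin cantor_top P")
    case True
    then have "cantor_top derived_set_of P \<subseteq> P" by (simp add: closedin_contains_derived_set)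
    then show ?thesis unfolding perfect_set_def using der by blast
  qed (simp add: perfect_set_def)
qed

lemma perfect_set_UNIV: "perfect_set UNIV"
  unfolding perfect_set_iff
proof (intro conjI ballI allI)
  fix x n
  show "\<exists>y\<in>UNIV. y \<noteq> x \<and> y \<in> cyl x n"
    by (rule bexI[of _ "x(n := \<not> x n)"]) (auto simp: cyl_def fun_eq_iff)
qed (use closedin_topspace[of cantor_top] in auto)

lemma perfect_set_closedin: "perfect_set P \<Longrightarrow> closedin cantor_top P"
  by (simp add: perfect_set_def)

lemma perfect_set_Int_cyl:
  assumes "perfect_set P" "x \<in> P" shows "perfect_set (P \<inter> cyl x n)"
  unfolding perfect_set_iff
proof (intro conjI ballI allI)
  show "P \<inter> cyl x n \<noteq> {}" using assms(2) cyl_self by blast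
  have "closedin cantor_top (cyl x n)"
    unfolding closedin_cantor_top_iff using cyl_eq cyl_self cyl_sym by blast
  then show "closedin cantor_top (P \<inter> cyl x n)"
    using assms(1) by (simp add: perfect_set_closedin closedin_Int)
next
  fix y m assume y: "y \<in> P \<inter> cyl x n"
  then obtain z where z: "z \<in> P" "z \<noteq> y" "z \<in> cyl y (max m n)"
    using assms(1) unfolding perfect_set_iff by blast
  then have "z \<in> cyl y m" "z \<in> cyl y n" using cyl_mono by (meson max.cobounded1 max.cobounded2 subsetD)+
  then show "\<exists>z\<in>P \<inter> cyl x n. z \<noteq> y \<and> z \<in> cyl y m" using z y cyl_eq by blast
qed

lemma infinite_perfect_set_cantor:
  assumes "perfect_set P" shows "infinite P"
proof
  assume fin: "finite P"
  obtain x where x: "x \<in> P" using assms by (auto simp: perfect_set_def)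
  have "\<forall>y\<in>P - {x}. \<exists>n. y \<notin> cyl x n" using cyl_separates by (metis Diff_iff singleton_iff)
  then obtain f where f: "\<forall>y\<in>P - {x}. y \<notin> cyl x (f y)" by metis
  obtain y where "y \<in> P" "y \<noteq> x" "y \<in> cyl x (Max (f ` P))"
    using assms x unfolding perfect_set_iff by blast
  moreover have "f y \<le> Max (f ` P)" using fin \<open>y \<in> P\<close> by simp
  ultimately show False using f cyl_mono by (meson Diff_iff singleton_iff subsetD)
qed

lemma nested_closedin_nonempty:
  assumes "\<And>n. closedin cantor_top (K n)" "\<And>n. K n \<noteq> {}" "decseq K"
  shows "(\<Inter>n. K n) \<noteq> {}"
proof -
  have "compact_space cantor_top"
    unfolding cantor_top_def by (simp add: compact_space_product_topology compact_space_discrete_topology)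
  then show ?thesis using assms compact_space_imp_nest by blast
qed

subsection \<open>The perfect set property\<close>

text \<open>Cantor-Bendixson argument: the condensation points of \<open>C\<close> form a perfect
  set. As there are only countably many cylinders, all but countably many points of \<open>C\<close>
  are condensation points.\<close>

lemma perfect_subset_uncountable:
  assumes C: "closedin cantor_top C" and unc: "uncountable C"
  shows "\<exists>P. perfect_set P \<and> P \<subseteq> C"
proof -
  define P where "P = {x \<in> C. \<forall>n. uncountable (C \<inter> cyl x n)}"
  define \<U> where "\<U> = {U \<in> {cyl x n | x n. True}. countable (C \<inter> U)}"
  have "countable \<U>"
    unfolding \<U>_def using countable_cyls by (rule countable_subset[rotated]) blast
  then have "countable (\<Union>U\<in>\<U>. C \<inter> U)"
    by (rule countable_UN) (simp add: \<U>_def)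
  moreover have "C - P \<subseteq> (\<Union>U\<in>\<U>. C \<inter> U)"
  proof
    fix x assume "x \<in> C - P"
    then obtain n where "x \<in> C" "countable (C \<inter> cyl x n)" by (auto simp: P_def)
    then show "x \<in> (\<Union>U\<in>\<U>. C \<inter> U)"
      by (intro UN_I[of "cyl x n"]) (auto simp: \<U>_def)
  qed
  ultimately have small: "countable (C - P)" by (rule countable_subset[rotated])
  have "perfect_set P"
    unfolding perfect_set_iff
  proof (intro conjI ballI allI)
    show "P \<noteq> {}" using small unc by auto
    show "closedin cantor_top P"
      unfolding closedin_cantor_top_iff
    proof (intro allI impI)
      fix x assume x: "\<forall>n. cyl x n \<inter> P \<noteq> {}"
      then have "\<forall>n. cyl x n \<inter> C \<noteq> {}" by (auto simp: P_def disjoint_iff)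
      then have "x \<in> C" using C unfolding closedin_cantor_top_iff by simp
      moreover have "uncountable (C \<inter> cyl x n)" for n
      proof -
        obtain y where "y \<in> cyl x n" "y \<in> P" using x by blast
        then have "uncountable (C \<inter> cyl y n)" by (simp add: P_def)
        then show ?thesis using cyl_eq[OF \<open>y \<in> cyl x n\<close>] by simp
      qed
      ultimately show "x \<in> P" by (simp add: P_def)
    qed
  next
    fix x n assume "x \<in> P"
    then have "uncountable (C \<inter> cyl x n)" by (simp add: P_def)
    then have "\<not> C \<inter> cyl x n \<subseteq> insert x (C - P)"
      using small countable_subset countable_insert by metis
    then show "\<exists>y\<in>P. y \<noteq> x \<and> y \<in> cyl x n" by auto
  qed
  moreover have "P \<subseteq> C" by (auto simp: P_def)
  ultimately show ?thesis by blast
qed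

subsection \<open>Continuum many disjoint perfect subsets\<close>

text \<open>For \<open>x\<close> in \<open>P\<close>, this makes the prefix of \<open>x\<close> of
  length \<open>n\<close> a splitting node of the tree of \<open>P\<close>.\<close>

definition splits_at :: "cantor set \<Rightarrow> cantor \<Rightarrow> nat \<Rightarrow> bool" where
  "splits_at P x n \<longleftrightarrow> (\<exists>y\<in>P. y \<in> cyl x n \<and> y n \<noteq> x n)"

lemma splits_at_cong:
  assumes "y \<in> cyl x m" "n < m" shows "splits_at P y n \<longleftrightarrow> splits_at P x n"
proof -
  have "cyl y n = cyl x n" using assms cyl_mono[of n m x] cyl_eq by (meson less_imp_le subsetD)
  moreover have "y n = x n" using assms by (simp add: cyl_def)
  ultimately show ?thesis by (simp add: splits_at_def)
qed

lemma splits_at_unbounded: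
  assumes "perfect_set P" "x \<in> P" shows "\<exists>n\<ge>m. splits_at P x n"
proof -
  obtain y where y: "y \<in> P" "y \<noteq> x" "y \<in> cyl x m" using assms unfolding perfect_set_iff by blast
  define n where "n = (LEAST n. y n \<noteq> x n)"
  obtain k where "y k \<noteq> x k" using y(2) by auto
  then have "y n \<noteq> x n" unfolding n_def by (rule LeastI)
  moreover have "y i = x i" if "i < n" for i using not_less_Least that unfolding n_def by blast
  ultimately have "splits_at P x n" using y(1) by (auto simp: splits_at_def cyl_def)
  moreover have "m \<le> n"
    using y(3) \<open>y n \<noteq> x n\<close> by (auto simp: cyl_def not_less[symmetric])
  ultimately show ?thesis by blast
qed

text \<open>\<open>LEAST\<close> is meaningful for \<open>x\<close> in a perfect \<open>P\<close>,
  where \<open>splits_at_unbounded\<close> supplies splitting nodes at arbitrary heights.\<close>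

fun split_level :: "cantor set \<Rightarrow> cantor \<Rightarrow> nat \<Rightarrow> nat" where
  "split_level P x 0 = (LEAST n. splits_at P x n)"
| "split_level P x (Suc k) = (LEAST n. n > split_level P x k \<and> splits_at P x n)"

lemma splits_at_split_level:
  assumes "perfect_set P" "x \<in> P" shows "splits_at P x (split_level P x k)"
proof (cases k)
  case 0
  then show ?thesis using splits_at_unbounded[OF assms] by (auto intro: LeastI)
next
  case (Suc k)
  have "\<exists>n. n > split_level P x k \<and> splits_at P x n"
    using splits_at_unbounded[OF assms, of "Suc (split_level P x k)"] by (auto simp: Suc_le_eq)
  from LeastI_ex[OF this] show ?thesis by (simp add: Suc)
qed

lemma split_level_less:
  assumes "perfect_set P" "x \<in> P" shows "split_level P x k < split_level P x (Suc k)"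
proof -
  have "\<exists>n. n > split_level P x k \<and> splits_at P x n"
    using splits_at_unbounded[OF assms, of "Suc (split_level P x k)"] by (auto simp: Suc_le_eq)
  from LeastI_ex[OF this] show ?thesis by simp
qed

lemma strict_mono_split_level:
  assumes "perfect_set P" "x \<in> P" shows "strict_mono (split_level P x)"
  using split_level_less[OF assms] by (auto simp: strict_mono_Suc_iff simp del: split_level.simps)

text \<open>Splitting at a lower height depends on the common prefix alone, so both points pass the
  same nodes before the \<open>k\<close>-th one, and that node splits for both.\<close>

lemma split_level_cong:
  assumes P: "perfect_set P" "x \<in> P" "y \<in> P" and y: "y \<in> cyl x (split_level P x k)"
  shows "split_level P y k = split_level P x k"
proof -
  \<comment> \<open>Both points extend the same splitting node. If they leave it in the same
    direction, \<open>z\<close> witnesses the splitting for \<open>y\<close>; otherwise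
    \<open>x\<close> does.\<close>
  have at: "splits_at P y (split_level P x k)" if "y \<in> cyl x (split_level P x k)" for k
  proof -
    let ?n = "split_level P x k"
    have "splits_at P x ?n" using splits_at_split_level P by blast
    then obtain z where z: "z \<in> P" "z \<in> cyl x ?n" "z ?n \<noteq> x ?n" by (auto simp: splits_at_def)
    have "cyl y ?n = cyl x ?n" using that by (rule cyl_eq)
    then have *: "x \<in> cyl y ?n" "z \<in> cyl y ?n" using z(2) cyl_self by simp_all
    show ?thesis
    proof (cases "y ?n = x ?n")
      case True
      then show ?thesis using * z unfolding splits_at_def by metis
    next
      case False
      then show ?thesis using * P(2) unfolding splits_at_def by metis
    qed
  qed
  show ?thesis using y
  proof (induction k)
    case 0
    have "splits_at P x n" if "n < split_level P x 0" "splits_at P y n" for n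
      using that splits_at_cong[OF "0"] by blast
    then have "split_level P x 0 \<le> n" if "splits_at P y n" for n
      using that not_less_Least by (metis not_le split_level.simps(1))
    then have "(LEAST n. splits_at P y n) = split_level P x 0"
      using at[OF "0"] by (intro Least_equality)
    then show ?case by simp
  next
    case (Suc k)
    have "split_level P x k \<le> split_level P x (Suc k)"
      using split_level_less[OF P(1,2)] by (simp add: less_imp_le)
    then have IH: "split_level P y k = split_level P x k"
      using Suc cyl_mono by blast
    have "split_level P x (Suc k) \<le> n" if "n > split_level P x k \<and> splits_at P y n" for n
    proof (rule ccontr)
      assume *: "\<not> split_level P x (Suc k) \<le> n"
      then have "splits_at P x n" using that splits_at_cong[OF Suc.prems] by simp
      then have "split_level P x (Suc k) \<le> n" using that by (auto intro: Least_le)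
      then show False using * by simp
    qed
    then have "(LEAST n. n > split_level P x k \<and> splits_at P y n) = split_level P x (Suc k)"
      using at[OF Suc.prems] split_level_less[OF P(1,2)] by (intro Least_equality) auto
    then show ?case using IH by simp
  qed
qed

text \<open>Records the turns at successive splitting nodes: the canonical map from the branches of
  a perfect tree to those of the full binary tree.\<close>

definition branch :: "cantor set \<Rightarrow> cantor \<Rightarrow> cantor" where
  "branch P x k = x (split_level P x k)"

text \<open>The common prefix reaches one place past the \<open>k\<close>-th splitting height, so
  that the turn taken there is shared as well.\<close>

lemma branch_cong:
  assumes P: "perfect_set P" "x \<in> P" "y \<in> P" and y: "y \<in> cyl x (Suc (split_level P x k))" and "j \<le> k"
  shows "branch P y j = branch P x j"
proof -
  have le: "split_level P x j \<le> split_level P x k"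
    using strict_mono_split_level[OF P(1,2)] \<open>j \<le> k\<close> by (simp add: strict_mono_less_eq)
  then have "y \<in> cyl x (split_level P x j)" using y cyl_mono by (meson le_SucI subsetD)
  then have "split_level P y j = split_level P x j" using split_level_cong P by blast
  then show ?thesis using y le by (simp add: branch_def cyl_def)
qed

lemma closedin_branch_prefix:
  assumes "perfect_set P" shows "closedin cantor_top {x \<in> P. \<forall>j<k. branch P x j = w j}"
  unfolding closedin_cantor_top_iff
proof (intro allI impI)
  fix x assume x: "\<forall>n. cyl x n \<inter> {x \<in> P. \<forall>j<k. branch P x j = w j} \<noteq> {}"
  then have "\<forall>n. cyl x n \<inter> P \<noteq> {}" by (auto simp: disjoint_iff)
  then have "x \<in> P" using perfect_set_closedin[OF assms] by (simp add: closedin_cantor_top_iff)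
  obtain y where y: "y \<in> cyl x (Suc (split_level P x k))" "y \<in> P" "\<forall>j<k. branch P y j = w j"
    using x by blast
  then have "\<forall>j<k. branch P x j = w j"
    using branch_cong[OF assms \<open>x \<in> P\<close> y(2,1)] by auto
  then show "x \<in> {x \<in> P. \<forall>j<k. branch P x j = w j}" using \<open>x \<in> P\<close> by simp
qed

text \<open>Induction on \<open>k\<close>: if \<open>x\<close> takes the wrong turn at its
  \<open>k\<close>-th splitting node, another point of \<open>P\<close> through that node takes the
  other turn and keeps the earlier ones.\<close>

lemma branch_prefix_nonempty:
  assumes P: "perfect_set P" shows "\<exists>x\<in>P. \<forall>j<k. branch P x j = w j"
proof (induction k)
  case 0
  show ?case using P by (auto simp: perfect_set_def)
next
  case (Suc k)
  then obtain x where x: "x \<in> P" "\<forall>j<k. branch P x j = w j" by blast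
  show ?case
  proof (cases "branch P x k = w k")
    case True
    then show ?thesis using x less_Suc_eq by auto
  next
    case False
    let ?n = "split_level P x k"
    obtain y where y: "y \<in> P" "y \<in> cyl x ?n" "y ?n \<noteq> x ?n"
      using splits_at_split_level[OF P x(1)] by (auto simp: splits_at_def)
    have "branch P y j = w j" if j: "j < k" for j
    proof -
      have "Suc (split_level P x j) \<le> ?n"
        using strict_mono_split_level[OF P x(1)] j by (simp add: Suc_le_eq strict_mono_less)
      then have "y \<in> cyl x (Suc (split_level P x j))" using y(2) cyl_mono by blast
      then show ?thesis using branch_cong[OF P x(1) y(1) _ order_refl] x(2) j by simp
    qed
    moreover have "branch P y k = w k"
      using y False split_level_cong[OF P x(1) y(1,2)] by (auto simp: branch_def)
    ultimately show ?thesis using y(1) less_Suc_eq by auto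
  qed
qed

text \<open>Compactness: the sets of points following the first \<open>k\<close> bits of
  \<open>w\<close> are closed, nonempty and decreasing.\<close>

lemma branch_surj:
  assumes "perfect_set P" shows "branch P ` P = UNIV"
proof -
  have "\<exists>x\<in>P. branch P x = w" for w
  proof -
    have "(\<Inter>k. {x \<in> P. \<forall>j<k. branch P x j = w j}) \<noteq> {}"
    proof (rule nested_closedin_nonempty)
      show "{x \<in> P. \<forall>j<k. branch P x j = w j} \<noteq> {}" for k
        using branch_prefix_nonempty[OF assms, of k w] by auto
    qed (auto simp: decseq_def closedin_branch_prefix assms)
    then show ?thesis by auto
  qed
  then show ?thesis by (auto simp: image_iff) metis
qed

lemma uncountable_UNIV_cantor: "uncountable (UNIV :: cantor set)"
proof
  assume "countable (UNIV :: cantor set)"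
  then obtain f :: "nat \<Rightarrow> cantor" where "surj f"
    using uncountable_def by blast
  then obtain n where "f n = (\<lambda>i. \<not> f i i)" by (metis surjD)
  then have "f n n = (\<not> f n n)" by metis
  then show False by simp
qed

lemma uncountable_perfect_set: "perfect_set P \<Longrightarrow> uncountable P"
  using branch_surj countable_image uncountable_UNIV_cantor by metis

text \<open>The turns with even index name the piece \<open>F w\<close>; those with odd index stay
  free, so \<open>F w\<close> is uncountable and includes a perfect set.\<close>

lemma disjoint_perfect_subsets:
  assumes P: "perfect_set P"
  obtains S :: "cantor \<Rightarrow> cantor set"
  where "\<And>w. perfect_set (S w)" "\<And>w. S w \<subseteq> P" "\<And>v w. v \<noteq> w \<Longrightarrow> S v \<inter> S w = {}"
proof -
  define F where "F w = {x \<in> P. \<forall>k. branch P x (2 * k) = w k}" for w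
  have clo: "closedin cantor_top (F w)" for w
  proof -
    have *: "closedin cantor_top {x \<in> P. branch P x (2 * k) = w k}" for k
      unfolding closedin_cantor_top_iff
    proof (intro allI impI)
      fix x assume x: "\<forall>n. cyl x n \<inter> {x \<in> P. branch P x (2 * k) = w k} \<noteq> {}"
      then have "\<forall>n. cyl x n \<inter> P \<noteq> {}" by (auto simp: disjoint_iff)
      then have "x \<in> P" using perfect_set_closedin[OF P] by (simp add: closedin_cantor_top_iff)
      obtain y where y: "y \<in> cyl x (Suc (split_level P x (2 * k)))" "y \<in> P" "branch P y (2 * k) = w k"
        using x by blast
      then show "x \<in> {x \<in> P. branch P x (2 * k) = w k}"
        using branch_cong[OF P \<open>x \<in> P\<close> y(2,1)] \<open>x \<in> P\<close> by auto
    qed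
    have "F w = (\<Inter>k. {x \<in> P. branch P x (2 * k) = w k})" by (auto simp: F_def)
    then show ?thesis using * by auto
  qed
  have "uncountable (F w)" for w
  proof
    assume "countable (F w)"
    then have "countable ((\<lambda>x k. branch P x (2 * k + 1)) ` F w)" by (rule countable_image)
    moreover have "v \<in> (\<lambda>x k. branch P x (2 * k + 1)) ` F w" for v
    proof -
      \<comment> \<open>Interleaving \<open>w\<close> and \<open>v\<close> gives a point of
        \<open>F w\<close> whose odd turns spell \<open>v\<close>.\<close>
      obtain x where "x \<in> P" "branch P x = (\<lambda>n. if even n then w (n div 2) else v (n div 2))"
        using branch_surj[OF P] by (metis (no_types, lifting) UNIV_I imageE)
      then show ?thesis by (intro image_eqI[of _ _ x]) (auto simp: F_def)
    qed
    ultimately show False using uncountable_UNIV_cantor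
      by (metis UNIV_eq_I)
  qed
  then have "\<exists>Q. perfect_set Q \<and> Q \<subseteq> F w" for w
    using perfect_subset_uncountable[OF clo] by simp
  then obtain S where S: "\<And>w. perfect_set (S w)" "\<And>w. S w \<subseteq> F w" by metis
  show ?thesis
  proof
    show "S v \<inter> S w = {}" if ne: "v \<noteq> w" for v w
    proof -
      have "\<exists>k. v k \<noteq> w k" using ne by (simp add: fun_eq_iff)
      then obtain k where "v k \<noteq> w k" by blast
      then have "F v \<inter> F w = {}" by (auto simp: F_def)
      then show ?thesis using S by blast
    qed
  qed (use S in \<open>auto simp: F_def\<close>)
qed

subsection \<open>Fusion\<close>

lemma cyl_separates_finite:
  assumes "finite A" shows "\<exists>n\<ge>m. \<forall>a\<in>A. \<forall>b\<in>A. a \<noteq> b \<longrightarrow> b \<notin> cyl a n"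
proof -
  have "\<forall>p\<in>A \<times> A. \<exists>n. fst p \<noteq> snd p \<longrightarrow> snd p \<notin> cyl (fst p) n"
    using cyl_separates by metis
  then obtain f where f: "\<forall>p\<in>A \<times> A. fst p \<noteq> snd p \<longrightarrow> snd p \<notin> cyl (fst p) (f p)" by metis
  \<comment> \<open>The sum is a common upper bound for all separating depths, also when
    \<open>A\<close> is empty.\<close>
  define n where "n = m + (\<Sum>p\<in>A \<times> A. f p)"
  have "b \<notin> cyl a n" if "a \<in> A" "b \<in> A" "a \<noteq> b" for a b
  proof -
    have "f (a, b) \<le> (\<Sum>p\<in>A \<times> A. f p)"
      using assms that by (intro member_le_sum) auto
    then have "cyl a n \<subseteq> cyl a (f (a, b))" by (intro cyl_mono) (simp add: n_def)
    then show ?thesis using f that by fastforce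
  qed
  then show ?thesis by (intro exI[of _ n]) (auto simp: n_def)
qed

text \<open>Finite good sets grow towards a perfect set. By \<open>extend\<close> only countably
  many points are bad to add, so a good one lies in every cylinder around a point of
  \<open>P\<close>; by \<open>perturb\<close> goodness survives small changes, which carries it over
  to limit points.\<close>

lemma fusion:
  assumes P: "perfect_set P" and nonempty: "good {}"
    and extend: "\<And>A. finite A \<Longrightarrow> A \<subseteq> P \<Longrightarrow> good A \<Longrightarrow> countable {e \<in> P. \<not> good (insert e A)}"
    and perturb: "\<And>A. finite A \<Longrightarrow> A \<subseteq> P \<Longrightarrow> good A \<Longrightarrow>
        \<exists>m. \<forall>g. (\<forall>a\<in>A. g a \<in> cyl a m) \<longrightarrow> good (g ` A)"
    and mono: "\<And>A B. good A \<Longrightarrow> B \<subseteq> A \<Longrightarrow> good B"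
  obtains Q where "perfect_set Q" "Q \<subseteq> P" "\<And>A. finite A \<Longrightarrow> A \<subseteq> Q \<Longrightarrow> good A"
proof -
  \<comment> \<open>A state consists of a finite set and a depth to which its points may be
    perturbed.\<close>
  define robust where "robust A m \<longleftrightarrow> (\<forall>g. (\<forall>a\<in>A. g a \<in> cyl a m) \<longrightarrow> good (g ` A))" for A m
  define inv where "inv s \<longleftrightarrow> finite (fst s) \<and> fst s \<subseteq> P \<and> fst s \<noteq> {} \<and> robust (fst s) (snd s)"
    for s :: "cantor set \<times> nat"
  \<comment> \<open>New points stay within the tolerance of old ones, and every old point gets a
    companion nearby; the companions will rule out isolated points.\<close>
  define step where "step s t \<longleftrightarrow> fst s \<subseteq> fst t \<and> snd s < snd t \<and> fst t \<subseteq> (\<Union>a\<in>fst s. cyl a (snd s)) \<and>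
      (\<forall>a\<in>fst s. \<exists>b\<in>fst t. b \<noteq> a \<and> b \<in> cyl a (snd s))" for s t :: "cantor set \<times> nat"
  have robust_mono: "robust A n" if "robust A m" "m \<le> n" for A m n
    using that cyl_mono[OF \<open>m \<le> n\<close>] unfolding robust_def by blast
  have robust_ex: "\<exists>n\<ge>m. robust A n" if "finite A" "A \<subseteq> P" "good A" for A m
    using perturb[OF that] robust_mono unfolding robust_def by (metis nle_le)
  have robust_good: "good A" if "robust A m" for A m
    using that unfolding robust_def by (metis cyl_self image_ident)
  have add_point: "\<exists>e\<in>P. e \<noteq> a \<and> e \<in> cyl a m \<and> good (insert e A)"
    if "finite A" "A \<subseteq> P" "good A" "a \<in> P" for A a m
  proof -
    have "uncountable (P \<inter> cyl a m)"
      using uncountable_perfect_set[OF perfect_set_Int_cyl[OF P \<open>a \<in> P\<close>]] .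
    moreover have "countable (insert a {e \<in> P. \<not> good (insert e A)})"
      using extend[OF that(1-3)] by simp
    ultimately have "\<not> P \<inter> cyl a m \<subseteq> insert a {e \<in> P. \<not> good (insert e A)}"
      using countable_subset by blast
    then show ?thesis by blast
  qed
  obtain p where "p \<in> P" using P by (auto simp: perfect_set_def)
  then obtain e where "e \<in> P" "good {e}" using add_point[of "{}" p] nonempty by auto
  then obtain n where "robust {e} n" using robust_ex[of "{e}"] by auto
  then have init: "inv ({e}, n)" using \<open>e \<in> P\<close> by (simp add: inv_def)
  have "\<exists>t. inv t \<and> step s t" if "inv s" for s
  proof -
    obtain A m where s: "s = (A, m)" by force
    then have A: "finite A" "A \<subseteq> P" "A \<noteq> {}" "good A" using that robust_good by (auto simp: inv_def)
    \<comment> \<open>Companions are added one at a time; \<open>C\<close> holds the points of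
      \<open>A\<close> that have been served.\<close>
    have "\<exists>B. finite B \<and> B \<subseteq> P \<and> good B \<and> A \<subseteq> B \<and> B \<subseteq> (\<Union>a\<in>A. cyl a m) \<and>
        (\<forall>a\<in>C. \<exists>b\<in>B. b \<noteq> a \<and> b \<in> cyl a m)" if "finite C" "C \<subseteq> A" for C
      using that
    proof (induction C)
      case empty
      show ?case using A by (intro exI[of _ A]) auto
    next
      case (insert c C)
      then obtain B where B: "finite B" "B \<subseteq> P" "good B" "A \<subseteq> B" "B \<subseteq> (\<Union>a\<in>A. cyl a m)"
        "\<forall>a\<in>C. \<exists>b\<in>B. b \<noteq> a \<and> b \<in> cyl a m" by auto
      obtain e where e: "e \<in> P" "e \<noteq> c" "e \<in> cyl c m" "good (Set.insert e B)"
        using add_point[OF B(1-3), of c m] insert.prems A(2) by blast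
      show ?case
        using B e insert.prems by (intro exI[of _ "Set.insert e B"]) auto
    qed
    from this[OF A(1) order_refl] obtain B where B: "finite B" "B \<subseteq> P" "good B" "A \<subseteq> B"
      "B \<subseteq> (\<Union>a\<in>A. cyl a m)" "\<forall>a\<in>A. \<exists>b\<in>B. b \<noteq> a \<and> b \<in> cyl a m" by blast
    obtain n where "n \<ge> Suc m" "robust B n" using robust_ex[OF B(1-3)] by blast
    then have "inv (B, n) \<and> step s (B, n)" using B A(3) by (auto simp: inv_def step_def s)
    then show ?thesis by blast
  qed
  then obtain \<sigma> where \<sigma>: "\<And>k. inv (\<sigma> k)" "\<And>k. step (\<sigma> k) (\<sigma> (Suc k))"
    using dependent_nat_choice[of "\<lambda>_. inv" "\<lambda>_. step"] init by metis
  define A where "A k = fst (\<sigma> k)" for k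
  define m where "m k = snd (\<sigma> k)" for k
  have A: "finite (A k)" "A k \<subseteq> P" "A k \<noteq> {}" "robust (A k) (m k)" for k
    using \<sigma>(1)[of k] by (simp_all add: inv_def A_def m_def)
  have step: "A k \<subseteq> A (Suc k)" "m k < m (Suc k)" "A (Suc k) \<subseteq> (\<Union>a\<in>A k. cyl a (m k))"
    "\<forall>a\<in>A k. \<exists>b\<in>A (Suc k). b \<noteq> a \<and> b \<in> cyl a (m k)" for k
    using \<sigma>(2)[of k] by (simp_all add: step_def A_def m_def)
  have A_mono: "A j \<subseteq> A k" if "j \<le> k" for j k
    using lift_Suc_mono_le[of A, OF step(1) that] .
  have m_mono: "strict_mono m"
    using step(2) by (simp add: strict_mono_Suc_iff)
  \<comment> \<open>Points of all stages, earlier and later, lie in the cylinders of stage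
    \<open>k\<close>.\<close>
  have cover: "A j \<subseteq> (\<Union>a\<in>A k. cyl a (m k))" for j k
  proof (cases "j \<le> k")
    case True
    then show ?thesis using A_mono cyl_self by blast
  next
    case False
    have A_Suc: "A (Suc j) \<subseteq> (\<Union>a\<in>A j. cyl a (m j))" for j by (rule step(3))
    have "k \<le> j" using False by simp
    then show ?thesis
    proof (induction j rule: dec_induct)
      case base
      show ?case using cyl_self by blast
    next
      case (step j)
      show ?case
      proof
        fix x assume "x \<in> A (Suc j)"
        then obtain b where b: "b \<in> A j" "x \<in> cyl b (m j)" using A_Suc by blast
        obtain a where a: "a \<in> A k" "b \<in> cyl a (m k)" using step.IH b(1) by blast
        have "m k \<le> m j" using m_mono step.hyps by (simp add: strict_mono_less_eq)
        then have "x \<in> cyl b (m k)" using b(2) cyl_mono by blast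
        then show "x \<in> (\<Union>a\<in>A k. cyl a (m k))" using a cyl_eq by blast
      qed
    qed
  qed
  \<comment> \<open>The closure of the union of all stages.\<close>
  define Q where "Q = {x. \<forall>n. cyl x n \<inter> (\<Union>k. A k) \<noteq> {}}"
  have A_Q: "A k \<subseteq> Q" for k
  proof
    fix x assume "x \<in> A k"
    then have "x \<in> cyl x n \<inter> (\<Union>k. A k)" for n by auto
    then show "x \<in> Q" unfolding Q_def by blast
  qed
  have Q_cover: "\<exists>a\<in>A k. x \<in> cyl a (m k)" if x: "x \<in> Q" for x k
  proof -
    obtain b j where b: "b \<in> cyl x (m k)" "b \<in> A j" using x unfolding Q_def by blast
    then obtain a where "a \<in> A k" "b \<in> cyl a (m k)" using cover by blast
    then show ?thesis using b(1) cyl_eq cyl_sym by blast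
  qed
  show ?thesis
  proof
    show "Q \<subseteq> P"
    proof
      fix x assume "x \<in> Q"
      then have "\<forall>n. cyl x n \<inter> P \<noteq> {}" using A(2) unfolding Q_def by blast
      then show "x \<in> P" using perfect_set_closedin[OF P] by (simp add: closedin_cantor_top_iff)
    qed
    show "perfect_set Q"
      unfolding perfect_set_iff
    proof (intro conjI ballI allI)
      show "Q \<noteq> {}" using A(3) A_Q by blast
      show "closedin cantor_top Q"
        unfolding closedin_cantor_top_iff
      proof (intro allI impI)
        fix x assume x: "\<forall>n. cyl x n \<inter> Q \<noteq> {}"
        have "cyl x n \<inter> (\<Union>k. A k) \<noteq> {}" for n
        proof -
          obtain y where "y \<in> cyl x n" "y \<in> Q" using x by blast
          moreover have "cyl y n \<inter> (\<Union>k. A k) \<noteq> {}" using \<open>y \<in> Q\<close> unfolding Q_def by blast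
          ultimately show ?thesis using cyl_eq by simp
        qed
        then show "x \<in> Q" by (simp add: Q_def)
      qed
    next
      fix x n assume "x \<in> Q"
      then obtain a where a: "a \<in> A n" "x \<in> cyl a (m n)" using Q_cover by blast
      obtain b where b: "b \<in> A (Suc n)" "b \<noteq> a" "b \<in> cyl a (m n)" using step(4) a(1) by blast
      have "n \<le> m n" using m_mono by (rule strict_mono_imp_increasing)
      then have "cyl a (m n) \<subseteq> cyl x n" using cyl_eq[OF a(2)] cyl_mono by blast
      moreover have "a \<in> Q" "b \<in> Q" using a b A_Q by blast+
      ultimately show "\<exists>y\<in>Q. y \<noteq> x \<and> y \<in> cyl x n" using b cyl_self by (metis subsetD)
    qed
  next
    fix B assume B: "finite B" "B \<subseteq> Q"
    \<comment> \<open>At depth \<open>n\<close>, hence also at depth \<open>m n\<close>, the points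
      of \<open>B\<close> lie in distinct cylinders. So \<open>h\<close> is injective, and moving
      each \<open>h b\<close> back to \<open>b\<close> exhibits \<open>B\<close> as part of a
      permitted perturbation of \<open>A n\<close>.\<close>
    obtain n where n: "\<forall>a\<in>B. \<forall>b\<in>B. a \<noteq> b \<longrightarrow> b \<notin> cyl a n"
      using cyl_separates_finite[OF B(1)] by blast
    have "n \<le> m n" using m_mono by (rule strict_mono_imp_increasing)
    have "\<forall>b\<in>B. \<exists>a\<in>A n. b \<in> cyl a (m n)" using Q_cover B(2) by blast
    then obtain h where h: "\<forall>b\<in>B. h b \<in> A n \<and> b \<in> cyl (h b) (m n)" by metis
    have inj: "inj_on h B"
    proof (rule inj_onI, rule ccontr)
      fix a b assume ab: "a \<in> B" "b \<in> B" "h a = h b" "a \<noteq> b"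
      then have "b \<in> cyl a (m n)" using h cyl_eq by metis
      then have "b \<in> cyl a n" using \<open>n \<le> m n\<close> cyl_mono by blast
      then show False using n ab by blast
    qed
    define g where "g a = (if a \<in> h ` B then inv_into B h a else a)" for a
    have gh: "g (h b) = b" if "b \<in> B" for b using that inj by (simp add: g_def)
    have "g a \<in> cyl a (m n)" if "a \<in> A n" for a
    proof (cases "a \<in> h ` B")
      case True
      then obtain b where "b \<in> B" "a = h b" by blast
      then show ?thesis using gh h by simp
    qed (simp add: g_def)
    then have "good (g ` A n)" using A(4) unfolding robust_def by blast
    moreover have "B \<subseteq> g ` A n" using gh h by (metis image_eqI subsetI)
    ultimately show "good B" using mono by blast
  qed
qed

subsection \<open>Perfect sets almost disjoint from their translates\<close>

lemma cadd_assoc: "cadd (cadd x y) z = cadd x (cadd y z)"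
  by (auto simp: cadd_def)

lemma cadd_commute: "cadd x y = cadd y x"
  by (auto simp: cadd_def)

lemma cadd_left_cancel [simp]: "cadd x (cadd x y) = y"
  by (auto simp: cadd_def)

lemma cadd_eq_self_iff: "cadd z x = x \<longleftrightarrow> z = (\<lambda>_. False)"
  by (auto simp: cadd_def fun_eq_iff)

lemma cadd_left_inj [simp]: "cadd z x = cadd z y \<longleftrightarrow> x = y"
  by (metis cadd_left_cancel)

text \<open>A Sidon condition for a group of exponent 2: no four distinct points sum to
  zero.\<close>

definition thin :: "cantor set \<Rightarrow> bool" where
  "thin A \<longleftrightarrow> (\<forall>a\<in>A. \<forall>b\<in>A. \<forall>c\<in>A. \<forall>d\<in>A. distinct [a, b, c, d] \<longrightarrow> cadd a b \<noteq> cadd c d)"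

lemma thin_subset: "thin A \<Longrightarrow> B \<subseteq> A \<Longrightarrow> thin B"
  unfolding thin_def by blast

lemma thin_perfect_subset:
  assumes "perfect_set P" obtains Q where "perfect_set Q" "Q \<subseteq> P" "thin Q"
proof -
  have "\<exists>Q. perfect_set Q \<and> Q \<subseteq> P \<and> (\<forall>A. finite A \<longrightarrow> A \<subseteq> Q \<longrightarrow> thin A)"
  proof (rule fusion[OF assms, of thin])
    show "thin {}" by (simp add: thin_def)
    show "thin B" if "thin A" "B \<subseteq> A" for A B using that by (rule thin_subset)
  next
    fix A assume A: "finite A" "A \<subseteq> P" "thin A"
    \<comment> \<open>Solving a forbidden equation for the new point \<open>e\<close> writes it as a
      sum of three points of \<open>A\<close>, which leaves finitely many bad choices.\<close>
    let ?S = "(\<lambda>(a, b, c). cadd a (cadd b c)) ` (A \<times> A \<times> A)"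
    have "e \<in> A \<union> ?S" if nt: "\<not> thin (insert e A)" for e
    proof (rule ccontr)
      assume e: "e \<notin> A \<union> ?S"
      have ne: "e \<noteq> cadd a (cadd b c)" if "a \<in> A" "b \<in> A" "c \<in> A" for a b c
        using e that by force
      obtain a b c d where abcd: "a \<in> insert e A" "b \<in> insert e A" "c \<in> insert e A" "d \<in> insert e A"
        "distinct [a, b, c, d]" "cadd a b = cadd c d"
        using nt unfolding thin_def by blast
      have sum: "a = cadd b (cadd c d)" "b = cadd a (cadd c d)" "c = cadd d (cadd a b)" "d = cadd c (cadd a b)"
        using abcd(6) by (metis cadd_commute cadd_left_cancel)+
      have "\<not> {a, b, c, d} \<subseteq> A" using A(3) abcd(5,6) unfolding thin_def by blast
      then consider "e = a" | "e = b" | "e = c" | "e = d" using abcd(1-4) by blast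
      then show False
      proof cases
        case 1
        then have "b \<in> A" "c \<in> A" "d \<in> A" using abcd by auto
        then show False using ne sum(1) 1 by blast
      next
        case 2
        then have "a \<in> A" "c \<in> A" "d \<in> A" using abcd by auto
        then show False using ne sum(2) 2 by blast
      next
        case 3
        then have "a \<in> A" "b \<in> A" "d \<in> A" using abcd by auto
        then show False using ne sum(3) 3 by blast
      next
        case 4
        then have "a \<in> A" "b \<in> A" "c \<in> A" using abcd by auto
        then show False using ne sum(4) 4 by blast
      qed
    qed
    then have "{e \<in> P. \<not> thin (insert e A)} \<subseteq> A \<union> ?S" by blast
    moreover have "finite (A \<union> ?S)" using A(1) by simp
    ultimately show "countable {e \<in> P. \<not> thin (insert e A)}"
      by (rule countable_subset[OF _ countable_finite])
  next
    fix A assume A: "finite A" "A \<subseteq> P" "thin A"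
    \<comment> \<open>If distinct pairwise sums differ below \<open>m\<close>, they still differ
      after the summands are changed beyond \<open>m\<close>.\<close>
    define B where "B = (\<lambda>(a, b). cadd a b) ` (A \<times> A)"
    have "finite B" using A(1) by (simp add: B_def)
    then obtain m where m: "\<forall>a\<in>B. \<forall>b\<in>B. a \<noteq> b \<longrightarrow> b \<notin> cyl a m"
      using cyl_separates_finite by blast
    have "thin (g ` A)" if g: "\<forall>a\<in>A. g a \<in> cyl a m" for g
      unfolding thin_def
    proof (intro ballI impI notI)
      fix a' b' c' d' assume *: "a' \<in> g ` A" "b' \<in> g ` A" "c' \<in> g ` A" "d' \<in> g ` A"
        "distinct [a', b', c', d']" "cadd a' b' = cadd c' d'"
      then obtain a b c d where abcd: "a \<in> A" "b \<in> A" "c \<in> A" "d \<in> A"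
        "a' = g a" "b' = g b" "c' = g c" "d' = g d" by blast
      then have "distinct [a, b, c, d]" using *(5) by auto
      then have "cadd a b \<noteq> cadd c d" using A(3) abcd unfolding thin_def by blast
      moreover have "cadd a b \<in> B" "cadd c d \<in> B" using abcd by (auto simp: B_def)
      ultimately have "cadd c d \<notin> cyl (cadd a b) m" using m by blast
      then obtain i where i: "i < m" "cadd c d i \<noteq> cadd a b i" by (auto simp: cyl_def)
      have "cadd a' b' i = cadd a b i" "cadd c' d' i = cadd c d i"
        using g abcd i(1) by (auto simp: cadd_def cyl_def)
      then show False using *(6) i(2) by simp
    qed
    then show "\<exists>m. \<forall>g. (\<forall>a\<in>A. g a \<in> cyl a m) \<longrightarrow> thin (g ` A)" by blast
  qed blast
  then obtain Q where Q: "perfect_set Q" "Q \<subseteq> P" "\<forall>A. finite A \<longrightarrow> A \<subseteq> Q \<longrightarrow> thin A" by blast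
  have "thin Q"
    unfolding thin_def
  proof (intro ballI impI)
    fix a b c d assume *: "a \<in> Q" "b \<in> Q" "c \<in> Q" "d \<in> Q" "distinct [a, b, c, d]"
    then have "thin {a, b, c, d}" using Q(3) by simp
    then show "cadd a b \<noteq> cadd c d" using *(5) unfolding thin_def by blast
  qed
  then show ?thesis using Q that by blast
qed

text \<open>If \<open>x\<close>, \<open>y\<close> and their translates by \<open>z\<close> are four points of \<open>T\<close>, then
  \<open>x + (x + z) = y + (y + z)\<close> contradicts thinness.\<close>

lemma thin_Int_translate:
  assumes "thin T" "z \<noteq> (\<lambda>_. False)" shows "finite {x \<in> T. cadd z x \<in> T}"
proof (cases "{x \<in> T. cadd z x \<in> T} = {}")
  case False
  then obtain x where x: "x \<in> T" "cadd z x \<in> T" by blast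
  have "y \<in> {x, cadd z x}" if y: "y \<in> T" "cadd z y \<in> T" for y
  proof (rule ccontr)
    assume "y \<notin> {x, cadd z x}"
    moreover have "cadd z x \<noteq> x" "cadd z y \<noteq> y" using assms(2) by (simp_all add: cadd_eq_self_iff)
    ultimately have "distinct [x, cadd z x, y, cadd z y]"
      by auto
    then have "cadd x (cadd z x) \<noteq> cadd y (cadd z y)"
      using assms(1) x y unfolding thin_def by blast
    then show False by (auto simp: cadd_def)
  qed
  then have "{x \<in> T. cadd z x \<in> T} \<subseteq> {x, cadd z x}" by blast
  then show ?thesis using finite_subset by blast
next
  case True
  show ?thesis unfolding True by simp
qed

subsection \<open>Cardinals below the continuum\<close>

abbreviation below_continuum :: "'a set \<Rightarrow> bool" where
  "below_continuum A \<equiv> |A| <o |UNIV :: cantor set|"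

lemma below_continuum_countable: "countable A \<Longrightarrow> below_continuum A"
proof -
  assume "countable A"
  then have "\<nexists>f. f ` A = (UNIV :: cantor set)"
    using countable_image uncountable_UNIV_cantor by metis
  then show ?thesis using card_of_ordLess2[of "UNIV :: cantor set" A] by simp
qed

lemma below_continuum_Plus:
  "below_continuum A \<Longrightarrow> below_continuum B \<Longrightarrow> below_continuum (A <+> B)"
  using uncountable_UNIV_cantor by (intro card_of_Plus_ordLess_infinite) (auto intro: countable_finite)

text \<open>The common bound \<open>B\<close> limits the union by the maximum of \<open>I\<close>,
  \<open>B\<close> and \<open>nat\<close> in size, so regularity of the continuum does not
  enter.\<close>

lemma below_continuum_UN:
  assumes "below_continuum I" "below_continuum B" "\<And>i. i \<in> I \<Longrightarrow> |A i| \<le>o |B|"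
  shows "below_continuum (\<Union>i\<in>I. A i)"
proof -
  let ?K = "I <+> (B <+> (UNIV :: nat set))"
  have "infinite ?K" by (auto simp: finite_Plus_iff)
  moreover have "|I| \<le>o |?K|" by (rule card_of_Plus1)
  moreover have "|B| \<le>o |?K|"
    using card_of_Plus1 card_of_Plus2 ordLeq_transitive by blast
  ultimately have "|\<Union>i\<in>I. A i| \<le>o |?K|"
    using assms(3) ordLeq_transitive by (intro card_of_UNION_ordLeq_infinite) blast+
  moreover have "below_continuum ?K"
    using assms(1,2) below_continuum_countable[of "UNIV :: nat set"]
    by (intro below_continuum_Plus) simp_all
  ultimately show ?thesis by (rule ordLeq_ordLess_trans)
qed

text \<open>A closed set is determined by the finite prefixes of its points, and sets of finite
  words are coded by points of Cantor space.\<close>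

lemma card_of_perfect_sets: "|Collect perfect_set| \<le>o |UNIV :: cantor set|"
proof -
  let ?f = "\<lambda>P. {s. \<exists>x\<in>P. \<exists>n. s = map x [0..<n]}"
  have sub: "P \<subseteq> Q" if Q: "perfect_set Q" and eq: "?f P = ?f Q" for P Q :: "cantor set"
  proof
    fix x assume "x \<in> P"
    have "cyl x n \<inter> Q \<noteq> {}" for n
    proof -
      have "map x [0..<n] \<in> ?f P" using \<open>x \<in> P\<close> by blast
      then have "map x [0..<n] \<in> ?f Q" using eq by simp
      then obtain y k where y: "y \<in> Q" "map x [0..<n] = map y [0..<k]" by blast
      then have "k = n" by (metis diff_zero length_map length_upt)
      then have "y \<in> cyl x n" using y(2) by (auto simp: cyl_def list_eq_iff_nth_eq)
      then show ?thesis using y(1) by blast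
    qed
    then show "x \<in> Q" using perfect_set_closedin[OF Q] by (simp add: closedin_cantor_top_iff)
  qed
  have "inj_on ?f (Collect perfect_set)"
  proof (rule inj_onI)
    fix P Q assume *: "P \<in> Collect perfect_set" "Q \<in> Collect perfect_set" "?f P = ?f Q"
    show "P = Q" using sub[of Q P] sub[of P Q] * by simp
  qed
  moreover have "inj (\<lambda>(A :: bool list set) n. from_nat n \<in> A)"
  proof (rule injI)
    fix A B :: "bool list set"
    assume "(\<lambda>n. from_nat n \<in> A) = (\<lambda>n. from_nat n \<in> B)"
    then have "from_nat (to_nat s) \<in> A \<longleftrightarrow> from_nat (to_nat s) \<in> B" for s :: "bool list"
      by (rule fun_cong)
    then show "A = B" by auto
  qed
  ultimately have "inj_on ((\<lambda>A n. from_nat n \<in> A) \<circ> ?f) (Collect perfect_set)"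
    by (intro comp_inj_on) (auto intro: inj_on_subset)
  then show ?thesis using card_of_ordLeq[of "Collect perfect_set" "UNIV :: cantor set"] by blast
qed

subsection \<open>Translates\<close>

lemma translate_translate: "cadd y ` cadd z ` A = cadd (cadd y z) ` A"
  by (auto simp: image_image cadd_assoc)

lemma translate_translate_same [simp]: "cadd z ` cadd z ` A = A"
  by (simp add: image_image)

lemma cadd_cyl: "cadd z y \<in> cyl (cadd z x) n \<longleftrightarrow> y \<in> cyl x n"
  by (auto simp: cyl_def cadd_def)

lemma closedin_translate:
  assumes "closedin cantor_top C" shows "closedin cantor_top (cadd z ` C)"
  unfolding closedin_cantor_top_iff
proof (intro allI impI)
  fix x assume x: "\<forall>n. cyl x n \<inter> cadd z ` C \<noteq> {}"
  have "cyl (cadd z x) n \<inter> C \<noteq> {}" for n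
  proof -
    obtain y where "y \<in> C" "cadd z y \<in> cyl x n" using x by blast
    moreover have "y \<in> cyl (cadd z x) n" using cadd_cyl[of z "cadd z y"] \<open>cadd z y \<in> cyl x n\<close> by simp
    ultimately show ?thesis by blast
  qed
  then have "cadd z x \<in> C" using assms by (simp add: closedin_cantor_top_iff)
  then show "x \<in> cadd z ` C" by (metis cadd_left_cancel image_eqI)
qed

lemma perfect_set_translate:
  assumes "perfect_set P" shows "perfect_set (cadd z ` P)"
  unfolding perfect_set_iff
proof (intro conjI ballI allI)
  show "cadd z ` P \<noteq> {}" using assms by (auto simp: perfect_set_def)
  show "closedin cantor_top (cadd z ` P)" using assms by (intro closedin_translate perfect_set_closedin)
next
  fix x n assume "x \<in> cadd z ` P"
  then obtain y where y: "y \<in> P" "x = cadd z y" by blast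
  then obtain w where "w \<in> P" "w \<noteq> y" "w \<in> cyl y n" using assms unfolding perfect_set_iff by blast
  then show "\<exists>w\<in>cadd z ` P. w \<noteq> x \<and> w \<in> cyl x n"
    using y by (intro bexI[of _ "cadd z w"]) (auto simp: cadd_cyl)
qed

subsection \<open>Maximal almost disjoint families of perfect sets\<close>

text \<open>Almost disjoint means having countable intersection. The last clause expresses
  maximality: no perfect subset of \<open>T\<close> is almost disjoint from all members.\<close>

definition maximal_almost_disjoint :: "cantor set \<Rightarrow> cantor set set \<Rightarrow> bool" where
  "maximal_almost_disjoint T \<A> \<longleftrightarrow> (\<forall>S\<in>\<A>. perfect_set S \<and> S \<subseteq> T) \<and>
     (\<forall>S\<in>\<A>. \<forall>S'\<in>\<A>. S \<noteq> S' \<longrightarrow> countable (S \<inter> S')) \<and>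
     (\<forall>Q. perfect_set Q \<longrightarrow> Q \<subseteq> T \<longrightarrow> (\<exists>S\<in>\<A>. uncountable (Q \<inter> S)))"

text \<open>Zorn's lemma is applied to the families extending continuum many disjoint perfect sets,
  which secures the size of the maximal one.\<close>

lemma maximal_almost_disjoint_exists:
  assumes T: "perfect_set T"
  shows "\<exists>\<A>. maximal_almost_disjoint T \<A> \<and> |UNIV :: cantor set| \<le>o |\<A>|"
proof -
  obtain F :: "cantor \<Rightarrow> cantor set" where F: "\<And>w. perfect_set (F w)" "\<And>w. F w \<subseteq> T"
    "\<And>v w. v \<noteq> w \<Longrightarrow> F v \<inter> F w = {}"
    using disjoint_perfect_subsets[OF T] by metis
  define \<F> where "\<F> = {\<A>. range F \<subseteq> \<A> \<and> (\<forall>S\<in>\<A>. perfect_set S \<and> S \<subseteq> T) \<and>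
      (\<forall>S\<in>\<A>. \<forall>S'\<in>\<A>. S \<noteq> S' \<longrightarrow> countable (S \<inter> S'))}"
  have "countable (F v \<inter> F w)" if "F v \<noteq> F w" for v w
    using F(3)[of v w] that by (cases "v = w") simp_all
  then have "range F \<in> \<F>" using F(1,2) by (auto simp: \<F>_def)
  moreover have "\<Union>\<C> \<in> \<F>" if C: "\<C> \<noteq> {}" "subset.chain \<F> \<C>" for \<C>
  proof -
    have sub: "\<C> \<subseteq> \<F>" using C(2) by (simp add: subset.chain_def)
    have "countable (S \<inter> S')" if S: "S \<in> \<Union>\<C>" "S' \<in> \<Union>\<C>" "S \<noteq> S'" for S S'
    proof -
      obtain \<A> \<B> where AB: "\<A> \<in> \<C>" "\<B> \<in> \<C>" "S \<in> \<A>" "S' \<in> \<B>" using S by blast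
      then have "\<A> \<subseteq> \<B> \<or> \<B> \<subseteq> \<A>" using C(2) unfolding subset_chain_def by blast
      then obtain \<X> where "\<X> \<in> \<F>" "S \<in> \<X>" "S' \<in> \<X>" using AB sub by blast
      then show ?thesis using S(3) by (simp add: \<F>_def)
    qed
    moreover have "range F \<subseteq> \<Union>\<C>"
    proof -
      obtain \<A> where "\<A> \<in> \<C>" using C(1) by blast
      moreover have "range F \<subseteq> \<A>" using subsetD[OF sub \<open>\<A> \<in> \<C>\<close>] by (simp add: \<F>_def)
      ultimately show ?thesis by blast
    qed
    moreover have "perfect_set S \<and> S \<subseteq> T" if "S \<in> \<Union>\<C>" for S
      using that sub by (auto simp: \<F>_def)
    ultimately show ?thesis by (simp add: \<F>_def)
  qed
  ultimately have "\<exists>\<A>\<in>\<F>. \<forall>\<B>\<in>\<F>. \<A> \<subseteq> \<B> \<longrightarrow> \<B> = \<A>"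
    by (intro subset_Zorn_nonempty) auto
  then obtain \<A> where \<A>: "\<A> \<in> \<F>" "\<forall>\<B>\<in>\<F>. \<A> \<subseteq> \<B> \<longrightarrow> \<B> = \<A>"
    by blast
  show ?thesis
  proof (intro exI conjI)
    have "\<exists>S\<in>\<A>. uncountable (Q \<inter> S)" if Q: "perfect_set Q" "Q \<subseteq> T" for Q
    proof (rule ccontr)
      assume *: "\<not> (\<exists>S\<in>\<A>. uncountable (Q \<inter> S))"
      then have "insert Q \<A> \<in> \<F>" using \<A>(1) Q by (auto simp: \<F>_def Int_commute)
      then have "Q \<in> \<A>" using \<A>(2) by blast
      then show False using * uncountable_perfect_set[OF Q(1)] by auto
    qed
    then show "maximal_almost_disjoint T \<A>"
      using \<A>(1) unfolding maximal_almost_disjoint_def \<F>_def by simp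
    have "inj F"
    proof (rule injI, rule ccontr)
      fix v w assume "F v = F w" "v \<noteq> w"
      then have "F v = {}" using F(3) by blast
      then show False using F(1)[of v] by (simp add: perfect_set_def)
    qed
    then have "|UNIV :: cantor set| \<le>o |range F|" by (meson card_of_ordLeq order_refl)
    moreover have "|range F| \<le>o |\<A>|" using \<A>(1) by (intro card_of_mono1) (simp add: \<F>_def)
    ultimately show "|UNIV :: cantor set| \<le>o |\<A>|" by (rule ordLeq_transitive)
  qed
qed

subsection \<open>Translation invariant dense families not covering \<open>X\<close>\<close>

text \<open>The cardinals bounding all \<open>(z + Q) \<inter> X\<close>, each represented by the sets of that size.\<close>

definition levels :: "cantor set \<Rightarrow> cantor set \<Rightarrow> cantor set set" where
  "levels X Q = {B. below_continuum B \<and> (\<forall>z. |cadd z ` Q \<inter> X| \<le>o |B| )}"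

lemma levels_antimono: "Q \<subseteq> P \<Longrightarrow> levels X P \<subseteq> levels X Q"
proof
  fix B assume "Q \<subseteq> P" "B \<in> levels X P"
  moreover have "|cadd z ` Q \<inter> X| \<le>o |cadd z ` P \<inter> X|" for z
    using \<open>Q \<subseteq> P\<close> by (intro card_of_mono1) blast
  ultimately show "B \<in> levels X Q"
    unfolding levels_def using ordLeq_transitive by blast
qed

lemma levels_upward:
  "A \<in> levels X Q \<Longrightarrow> |A| \<le>o |B| \<Longrightarrow> below_continuum B \<Longrightarrow> B \<in> levels X Q"
  unfolding levels_def using ordLeq_transitive by blast

lemma levels_translate [simp]: "levels X (cadd z ` Q) = levels X Q"
proof -
  have "levels X Q \<subseteq> levels X (cadd z ` Q)" for z Q
    by (auto simp: levels_def translate_translate)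
  from this[of Q z] this[of "cadd z ` Q" z] show ?thesis by simp
qed

text \<open>Levels are upward closed in cardinality and can only grow when the set shrinks. A subset
  whose level contains the least cardinal attained below \<open>P\<close> therefore admits no
  further growth; if no level is inhabited, \<open>P\<close> itself works.\<close>

lemma homogeneous_perfect_subset:
  assumes P: "perfect_set P"
  obtains Q where "perfect_set Q" "Q \<subseteq> P" "\<And>R. perfect_set R \<Longrightarrow> R \<subseteq> Q \<Longrightarrow> levels X R = levels X Q"
proof (cases "\<exists>Q. perfect_set Q \<and> Q \<subseteq> P \<and> levels X Q \<noteq> {}")
  case False
  have "levels X R = levels X P" if "perfect_set R" "R \<subseteq> P" for R
  proof -
    have "levels X R = {}" "levels X P = {}" using False that P by auto
    then show ?thesis by simp
  qed
  then show ?thesis using that[OF P order_refl] by blast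
next
  case True
  define U where "U = {r. \<exists>B Q. r = |B| \<and> perfect_set Q \<and> Q \<subseteq> P \<and> B \<in> levels X Q}"
  obtain r where r: "r \<in> U" using True by (auto simp: U_def)
  obtain r0 where r0: "r0 \<in> U" "\<And>s. (s, r0) \<in> ordLess \<Longrightarrow> s \<notin> U"
    using wfE_min[OF wf_ordLess r] by blast
  obtain B Q where Q: "r0 = |B|" "perfect_set Q" "Q \<subseteq> P" "B \<in> levels X Q"
    using r0(1) by (auto simp: U_def)
  show ?thesis
  proof
    fix R assume R: "perfect_set R" "R \<subseteq> Q"
    have "C \<in> levels X Q" if C: "C \<in> levels X R" for C
    proof -
      have "|C| \<in> U" using C R Q(3) by (auto simp: U_def)
      then have "\<not> |C| <o |B|" using r0(2) Q(1) by blast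
      then have "|B| \<le>o |C|"
        using ordLess_or_ordLeq[OF card_of_Well_order card_of_Well_order] by blast
      moreover have "below_continuum C" using C by (simp add: levels_def)
      ultimately show ?thesis using levels_upward[OF Q(4)] by blast
    qed
    then show "levels X R = levels X Q" using levels_antimono[OF R(2)] by blast
  qed (use Q in auto)
qed

definition noncovering :: "cantor set \<Rightarrow> cantor set set \<Rightarrow> bool" where
  "noncovering X \<D> \<longleftrightarrow> (\<forall>\<E>\<subseteq>\<D>. below_continuum \<E> \<longrightarrow> \<not> X \<subseteq> \<Union>\<E>)"

definition dense_family :: "cantor set set \<Rightarrow> bool" where
  "dense_family \<D> \<longleftrightarrow> (\<forall>Q\<in>\<D>. perfect_set Q) \<and> (\<forall>Q\<in>\<D>. \<forall>z. cadd z ` Q \<in> \<D>) \<and>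
     (\<forall>P. perfect_set P \<longrightarrow> (\<exists>Q\<in>\<D>. Q \<subseteq> P))"

text \<open>Each member of the family contains at most \<open>B\<close> many points of
  \<open>X\<close>, so fewer than continuum many members cover too few of them.\<close>

lemma dense_family_bounded:
  assumes X: "|UNIV :: cantor set| \<le>o |X|"
    and B: "\<And>P. perfect_set P \<Longrightarrow> \<exists>Q. perfect_set Q \<and> Q \<subseteq> P \<and> B \<in> levels X Q"
  shows "\<exists>\<D>. dense_family \<D> \<and> noncovering X \<D>"
proof (intro exI conjI)
  let ?D = "{Q. perfect_set Q \<and> B \<in> levels X Q}"
  show "dense_family ?D"
    using B by (auto simp: dense_family_def perfect_set_translate)
  show "noncovering X ?D"
    unfolding noncovering_def
  proof (intro allI impI notI)
    fix \<E> assume \<E>: "\<E> \<subseteq> ?D" "below_continuum \<E>" "X \<subseteq> \<Union>\<E>"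
    have "below_continuum B" using B[OF perfect_set_UNIV] by (auto simp: levels_def)
    moreover have "|E \<inter> X| \<le>o |B|" if "E \<in> \<E>" for E
    proof -
      have "|cadd (\<lambda>_. False) ` E \<inter> X| \<le>o |B|" using \<E>(1) that by (auto simp: levels_def)
      moreover have "cadd (\<lambda>_. False) ` E = E" by (auto simp: cadd_def)
      ultimately show ?thesis by simp
    qed
    ultimately have "below_continuum (\<Union>E\<in>\<E>. E \<inter> X)" using \<E>(2) by (intro below_continuum_UN)
    moreover have "(\<Union>E\<in>\<E>. E \<inter> X) = X" using \<E>(3) by blast
    ultimately show False using X not_ordLess_ordLeq by metis
  qed
qed

text \<open>The complementary case: every bound fails hereditarily below some perfect set, so each
  cardinal below the continuum is omitted by the level of some thin homogeneous set.\<close>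

lemma dense_family_unbounded:
  assumes unb: "\<And>B. below_continuum B \<Longrightarrow>
      \<exists>P. perfect_set P \<and> (\<forall>Q. perfect_set Q \<longrightarrow> Q \<subseteq> P \<longrightarrow> B \<notin> levels X Q)"
  shows "\<exists>\<D>. dense_family \<D> \<and> noncovering X \<D>"
proof -
  define hom where "hom T \<longleftrightarrow> perfect_set T \<and> thin T \<and>
      (\<forall>R. perfect_set R \<longrightarrow> R \<subseteq> T \<longrightarrow> levels X R = levels X T)" for T
  \<comment> \<open>One representative per level: a perfect set with translates inside
    \<open>T L\<close> and \<open>T L'\<close> has both levels, hence \<open>L = L'\<close>.\<close>
  define T where "T L = (SOME T. hom T \<and> levels X T = L)" for L
  define \<L> where "\<L> = levels X ` Collect hom"
  have T: "perfect_set (T L)" "thin (T L)" "levels X (T L) = L"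
    "\<And>R. perfect_set R \<Longrightarrow> R \<subseteq> T L \<Longrightarrow> levels X R = L" if "L \<in> \<L>" for L
  proof -
    have "\<exists>T. hom T \<and> levels X T = L" using that by (auto simp: \<L>_def)
    then have "hom (T L) \<and> levels X (T L) = L" unfolding T_def by (rule someI_ex)
    then show "perfect_set (T L)" "thin (T L)" "levels X (T L) = L"
      "\<And>R. perfect_set R \<Longrightarrow> R \<subseteq> T L \<Longrightarrow> levels X R = L" by (auto simp: hom_def)
  qed
  have hom_ex: "\<exists>L\<in>\<L>. B \<notin> L" if B: "below_continuum B" for B
  proof -
    obtain P where P: "perfect_set P" "\<forall>Q. perfect_set Q \<longrightarrow> Q \<subseteq> P \<longrightarrow> B \<notin> levels X Q"
      using unb[OF B] by blast
    \<comment> \<open>Thinness comes first because it passes to the homogeneous subset chosen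
      next.\<close>
    obtain P' where P': "perfect_set P'" "P' \<subseteq> P" "thin P'" using thin_perfect_subset[OF P(1)] by metis
    obtain Q where Q: "perfect_set Q" "Q \<subseteq> P'"
      "\<And>R. perfect_set R \<Longrightarrow> R \<subseteq> Q \<Longrightarrow> levels X R = levels X Q"
      using homogeneous_perfect_subset[OF P'(1), of X] by metis
    have "hom Q"
      unfolding hom_def using Q(1,3) thin_subset[OF P'(3) Q(2)] by blast
    moreover have "B \<notin> levels X Q" using P(2) P'(2) Q(1,2) by (meson order_trans)
    ultimately show ?thesis by (auto simp: \<L>_def)
  qed
  have "\<forall>L\<in>\<L>. \<exists>\<A>. maximal_almost_disjoint (T L) \<A> \<and> |UNIV :: cantor set| \<le>o |\<A>|"
    using T(1) maximal_almost_disjoint_exists by simp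
  then obtain \<A> where "\<forall>L\<in>\<L>. maximal_almost_disjoint (T L) (\<A> L) \<and> |UNIV :: cantor set| \<le>o |\<A> L|"
    by (rule bchoice[THEN exE])
  then have \<A>: "\<And>L S. L \<in> \<L> \<Longrightarrow> S \<in> \<A> L \<Longrightarrow> perfect_set S \<and> S \<subseteq> T L"
    "\<And>L S S'. L \<in> \<L> \<Longrightarrow> S \<in> \<A> L \<Longrightarrow> S' \<in> \<A> L \<Longrightarrow> S \<noteq> S' \<Longrightarrow> countable (S \<inter> S')"
    "\<And>L Q. L \<in> \<L> \<Longrightarrow> perfect_set Q \<Longrightarrow> Q \<subseteq> T L \<Longrightarrow> \<exists>S\<in>\<A> L. uncountable (Q \<inter> S)"
    "\<And>L. L \<in> \<L> \<Longrightarrow> |UNIV :: cantor set| \<le>o |\<A> L|"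
    by (simp_all add: maximal_almost_disjoint_def)
  define small where "small Q \<longleftrightarrow> (\<forall>L\<in>\<L>. \<forall>z. countable (cadd z ` Q \<inter> T L))" for Q
  define inside where "inside Q L z S \<longleftrightarrow> L \<in> \<L> \<and> S \<in> \<A> L \<and> cadd z ` Q \<subseteq> S" for Q L z S
  define \<D> where "\<D> = {Q. perfect_set Q \<and> (small Q \<or> (\<exists>L z S. inside Q L z S))}"
  have "dense_family \<D>"
    unfolding dense_family_def
  proof (intro conjI ballI allI impI)
    fix Q z assume Q: "Q \<in> \<D>"
    have "small (cadd z ` Q)" if "small Q"
      using that by (simp add: small_def translate_translate)
    moreover have "inside (cadd z ` Q) L (cadd w z) S" if "inside Q L w S" for L w S
    proof -
      have "cadd (cadd w z) ` cadd z ` Q = cadd w ` Q"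
        by (auto simp: image_image cadd_assoc)
      then show ?thesis using that by (simp add: inside_def)
    qed
    ultimately show "cadd z ` Q \<in> \<D>" using Q perfect_set_translate unfolding \<D>_def by (simp, metis)
  next
    fix P assume P: "perfect_set P"
    show "\<exists>Q\<in>\<D>. Q \<subseteq> P"
    proof (cases "small P")
      case True
      then show ?thesis using P by (auto simp: \<D>_def)
    next
      case False
      \<comment> \<open>Two refinements: into \<open>T L\<close>, then by maximality into a member
        of \<open>\<A> L\<close>. Translating by \<open>z\<close> again returns to
        \<open>P\<close>.\<close>
      then obtain L z where L: "L \<in> \<L>" and "uncountable (cadd z ` P \<inter> T L)" by (auto simp: small_def)
      moreover have "closedin cantor_top (cadd z ` P \<inter> T L)"
        using P T(1)[OF L] by (intro closedin_Int perfect_set_closedin perfect_set_translate)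
      ultimately obtain R where R: "perfect_set R" "R \<subseteq> cadd z ` P \<inter> T L"
        using perfect_subset_uncountable by blast
      then have "R \<subseteq> T L" by simp
      then obtain S where S: "S \<in> \<A> L" "uncountable (R \<inter> S)" using \<A>(3)[OF L R(1)] by blast
      moreover have "closedin cantor_top (R \<inter> S)"
        using R(1) \<A>(1)[OF L S(1)] by (intro closedin_Int perfect_set_closedin) auto
      ultimately obtain R' where R': "perfect_set R'" "R' \<subseteq> R \<inter> S"
        using perfect_subset_uncountable by blast
      have "inside (cadd z ` R') L z S" using L S R' by (simp add: inside_def)
      then have "cadd z ` R' \<in> \<D>" using perfect_set_translate[OF R'(1)] by (auto simp: \<D>_def)
      moreover have "cadd z ` R' \<subseteq> cadd z ` cadd z ` P" using R R' by (intro image_mono) blast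
      ultimately show ?thesis by auto
    qed
  qed (simp add: \<D>_def)
  moreover have "noncovering X \<D>"
    unfolding noncovering_def
  proof (intro allI impI notI)
    fix \<E> assume \<E>: "\<E> \<subseteq> \<D>" "below_continuum \<E>" "X \<subseteq> \<Union>\<E>"
    have K: "below_continuum (\<E> <+> (UNIV :: nat set))"
      using \<E>(2) below_continuum_countable[of "UNIV :: nat set"]
      by (intro below_continuum_Plus) simp_all
    \<comment> \<open>Levels consist of sets of points, so the cardinal of \<open>\<E>\<close>, made
      infinite by adding \<open>nat\<close>, is represented by such a set.\<close>
    then obtain B :: "cantor set" where B: "|\<E> <+> (UNIV :: nat set)| =o |B|"
      using internalize_card_of_ordLeq2 ordLess_imp_ordLeq by metis
    then have "below_continuum B" using K ordIso_ordLess_trans ordIso_symmetric by blast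
    then obtain L where L: "L \<in> \<L>" "B \<notin> L" using hom_ex by blast
    \<comment> \<open>Selects a member including a translate of \<open>E\<close>, with an arbitrary
      value if there is none. There are too few values to exhaust \<open>\<A> L\<close>, so some
      \<open>S\<close> is never selected.\<close>
    define used where "used E = (SOME S. \<exists>L z. inside E L z S)" for E
    have "|used ` \<E>| <o |\<A> L|"
      using card_of_image \<E>(2) \<A>(4)[OF L(1)] ordLeq_ordLess_trans ordLess_ordLeq_trans by metis
    then have "\<not> \<A> L \<subseteq> used ` \<E>" using card_of_mono1 not_ordLess_ordLeq by blast
    then obtain S where S: "S \<in> \<A> L" "S \<notin> used ` \<E>" by blast
    have "levels X S = L" using T(4)[OF L(1)] \<A>(1)[OF L(1) S(1)] by blast
    \<comment> \<open>This translate of \<open>S\<close> contains more points of \<open>X\<close>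
      than \<open>\<E>\<close> can cover, as each member of \<open>\<E>\<close> meets it in a
      countable set.\<close>
    then obtain z where z: "\<not> |cadd z ` S \<inter> X| \<le>o |B|"
      using L(2) \<open>below_continuum B\<close> by (auto simp: levels_def)
    have ctb: "countable (cadd z ` S \<inter> E)" if E: "E \<in> \<E>" for E
    proof (rule ccontr)
      assume "uncountable (cadd z ` S \<inter> E)"
      moreover have "perfect_set E" using E \<E>(1) by (auto simp: \<D>_def)
      then have "closedin cantor_top (cadd z ` S \<inter> E)"
        using \<A>(1)[OF L(1) S(1)] by (intro closedin_Int perfect_set_closedin perfect_set_translate) auto
      ultimately obtain R where R: "perfect_set R" "R \<subseteq> cadd z ` S \<inter> E"
        using perfect_subset_uncountable by blast
      have "cadd z ` R \<subseteq> cadd z ` cadd z ` S" using R(2) by (intro image_mono) blast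
      then have zR: "cadd z ` R \<subseteq> S" "cadd z ` R \<subseteq> T L" using \<A>(1)[OF L(1) S(1)] by auto
      show False
      proof (cases "small E")
        case True
        then have "countable (cadd z ` E \<inter> T L)" using L(1) by (simp add: small_def)
        moreover have "cadd z ` R \<subseteq> cadd z ` E \<inter> T L" using R(2) zR by blast
        ultimately show False
          using uncountable_perfect_set[OF perfect_set_translate[OF R(1)]] countable_subset by blast
      next
        case False
        have "E \<in> \<D>" using E \<E>(1) by blast
        then have "\<exists>S. \<exists>L z. inside E L z S" using False unfolding \<D>_def by blast
        then have "\<exists>L z. inside E L z (used E)" unfolding used_def by (rule someI_ex)
        then obtain L' z' where in': "L' \<in> \<L>" "used E \<in> \<A> L'" "cadd z' ` E \<subseteq> used E"
          by (auto simp: inside_def)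
        then have z'R: "cadd z' ` R \<subseteq> used E" "cadd z' ` R \<subseteq> T L'"
          using R(2) \<A>(1)[OF in'(1,2)] by auto
        \<comment> \<open>Levels are translation invariant, so \<open>R\<close> inherits its level
          from both \<open>T L\<close> and \<open>T L'\<close>.\<close>
        have "L' = levels X R"
          using T(4)[OF in'(1) perfect_set_translate[OF R(1)] z'R(2)] by simp
        also have "\<dots> = L"
          using T(4)[OF L(1) perfect_set_translate[OF R(1)] zR(2)] by simp
        finally have [simp]: "L' = L" .
        show False
        \<comment> \<open>Equal translations put one perfect set into two members of
          \<open>\<A> L\<close>; different ones put two translates of \<open>R\<close> into the thin
          set \<open>T L\<close>. Both are impossible.\<close>
        proof (cases "z' = z")
          case True
          have "used E \<noteq> S" using S(2) E by blast
          then have "countable (S \<inter> used E)" using \<A>(2)[OF L(1) S(1)] in'(2) by simp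
          moreover have "cadd z ` R \<subseteq> S \<inter> used E" using zR(1) z'R(1) True by blast
          ultimately show False
            using uncountable_perfect_set[OF perfect_set_translate[OF R(1)]] countable_subset by blast
        next
          case False
          have "cadd z' z \<noteq> (\<lambda>_. False)"
          proof
            assume "cadd z' z = (\<lambda>_. False)"
            then have "cadd z' (cadd z' z) = z'" by (auto simp: cadd_def)
            then show False using False by simp
          qed
          then have "finite {x \<in> T L. cadd (cadd z' z) x \<in> T L}"
            using thin_Int_translate T(2)[OF L(1)] by blast
          moreover have "cadd z ` R \<subseteq> {x \<in> T L. cadd (cadd z' z) x \<in> T L}"
            using zR(2) z'R(2) by (auto simp: cadd_assoc)
          ultimately show False
            using infinite_perfect_set_cantor[OF perfect_set_translate[OF R(1)]] finite_subset by blast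
        qed
      qed
    qed
    have "|\<Union>E\<in>\<E>. cadd z ` S \<inter> E| \<le>o |\<E> <+> (UNIV :: nat set)|"
    proof (rule card_of_UNION_ordLeq_infinite)
      show "infinite (\<E> <+> (UNIV :: nat set))" by (simp add: finite_Plus_iff)
      show "|\<E>| \<le>o |\<E> <+> (UNIV :: nat set)|" by (rule card_of_Plus1)
      show "\<forall>E\<in>\<E>. |cadd z ` S \<inter> E| \<le>o |\<E> <+> (UNIV :: nat set)|"
      proof
        fix E assume "E \<in> \<E>"
        then obtain f :: "cantor \<Rightarrow> nat" where "inj_on f (cadd z ` S \<inter> E)"
          using ctb by (auto simp: countable_def)
        then have "|cadd z ` S \<inter> E| \<le>o |UNIV :: nat set|"
          using card_of_ordLeq[of "cadd z ` S \<inter> E" "UNIV :: nat set"] by blast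
        then show "|cadd z ` S \<inter> E| \<le>o |\<E> <+> (UNIV :: nat set)|"
          using card_of_Plus2 ordLeq_transitive by blast
      qed
    qed
    moreover have "|cadd z ` S \<inter> X| \<le>o |\<Union>E\<in>\<E>. cadd z ` S \<inter> E|"
      using \<E>(3) by (intro card_of_mono1) blast
    ultimately have "|cadd z ` S \<inter> X| \<le>o |B|"
      using B ordLeq_transitive ordLeq_ordIso_trans by blast
    then show False using z by blast
  qed
  ultimately show ?thesis by blast
qed

lemma dense_noncovering_family:
  assumes "|UNIV :: cantor set| \<le>o |X|"
  obtains \<D> where "dense_family \<D>" "noncovering X \<D>"
proof (cases "\<exists>B. below_continuum B \<and> (\<forall>P. perfect_set P \<longrightarrow> (\<exists>Q. perfect_set Q \<and> Q \<subseteq> P \<and> B \<in> levels X Q))")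
  case True
  then show ?thesis using dense_family_bounded[OF assms] that by blast
next
  case False
  then have "\<exists>\<D>. dense_family \<D> \<and> noncovering X \<D>" by (intro dense_family_unbounded) blast
  then show ?thesis using that by blast
qed

section \<open>Construction of the Marczewski null set\<close>

text \<open>If \<open>Y\<close> met all of continuum many disjoint perfect subsets of
  \<open>Q\<close>, choosing a point in each would inject the continuum into
  \<open>Q \<inter> Y\<close>.\<close>

lemma avoid_below_continuum:
  assumes Q: "perfect_set Q" and Y: "below_continuum (Q \<inter> Y)"
  shows "\<exists>R. perfect_set R \<and> R \<subseteq> Q \<and> R \<inter> Y = {}"
proof -
  obtain S :: "cantor \<Rightarrow> cantor set" where S: "\<And>w. perfect_set (S w)" "\<And>w. S w \<subseteq> Q"
    "\<And>v w. v \<noteq> w \<Longrightarrow> S v \<inter> S w = {}"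
    using disjoint_perfect_subsets[OF Q] by metis
  show ?thesis
  proof (rule ccontr)
    assume "\<not> ?thesis"
    then have "\<forall>w. \<exists>y. y \<in> S w \<inter> Y" using S by blast
    then obtain f where f: "\<And>w. f w \<in> S w \<inter> Y" by metis
    then have "inj f" using S(3) by (intro injI) (metis IntD1 disjoint_iff)
    moreover have "range f \<subseteq> Q \<inter> Y" using f S(2) by blast
    ultimately have "|UNIV :: cantor set| \<le>o |Q \<inter> Y|" using card_of_ordLeq by blast
    then show False using Y not_ordLess_ordLeq by blast
  qed
qed

theorem theorem1p1:
  fixes X :: "cantor set"
  assumes "X \<approx> (UNIV :: cantor set)"
  shows "\<not> shiftable {Y. marczewski_null Y} X \<and>
         (\<exists>Y. marczewski_null Y \<and> setsum X Y = UNIV)"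
proof -
  obtain h where "bij_betw h X (UNIV :: cantor set)" using assms by (auto simp: eqpoll_def)
  then have "|UNIV :: cantor set| \<le>o |X|"
    using card_of_ordIsoI ordIso_symmetric ordIso_imp_ordLeq by blast
  then obtain \<D> where \<D>: "dense_family \<D>" "noncovering X \<D>"
    by (rule dense_noncovering_family)
  \<comment> \<open>A well-order of the points whose proper initial segments are below the
    continuum; through \<open>g\<close> it also indexes the perfect sets, possibly with
    repetitions.\<close>
  define r where "r = |UNIV :: cantor set|"
  have field: "Field r = UNIV" by (simp add: r_def Field_card_of)
  have under: "below_continuum (underS r a)" for a
    using card_of_underS[of r a] field by (simp add: r_def card_of_Card_order)
  have wo: "Well_order r" by (simp add: r_def card_of_Well_order)
  obtain g :: "cantor \<Rightarrow> cantor set" where g: "range g = Collect perfect_set"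
    using card_of_ordLeq2[of "Collect perfect_set" "UNIV :: cantor set"] card_of_perfect_sets
      perfect_set_UNIV by blast
  then have "\<forall>b. \<exists>Q. Q \<in> \<D> \<and> Q \<subseteq> g b" using \<D>(1) unfolding dense_family_def by blast
  then obtain Q where Q: "\<And>b. Q b \<in> \<D>" "\<And>b. Q b \<subseteq> g b" by metis
  \<comment> \<open>Translates of the \<open>Q b\<close> stay in \<open>\<D>\<close>, and the
    earlier indices are too few for them to cover \<open>X\<close>.\<close>
  have "\<exists>x\<in>X. \<forall>b\<in>underS r a. x \<notin> cadd a ` Q b" for a
  proof -
    have "below_continuum ((\<lambda>b. cadd a ` Q b) ` underS r a)"
      using card_of_image under by (rule ordLeq_ordLess_trans)
    moreover have "(\<lambda>b. cadd a ` Q b) ` underS r a \<subseteq> \<D>" using Q(1) \<D>(1) unfolding dense_family_def by blast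
    ultimately have "\<not> X \<subseteq> \<Union>((\<lambda>b. cadd a ` Q b) ` underS r a)"
      using \<D>(2) unfolding noncovering_def by blast
    then show ?thesis by blast
  qed
  then obtain x where x: "\<And>a. x a \<in> X" "\<And>a b. b \<in> underS r a \<Longrightarrow> x a \<notin> cadd a ` Q b" by metis
  define y where "y a = cadd a (x a)" for a
  have "marczewski_null (range y)"
    unfolding marczewski_null_def
  proof (intro allI impI)
    fix P assume "perfect_set P"
    then obtain b where b: "P = g b" using g by blast
    \<comment> \<open>If \<open>y a\<close> lies in \<open>Q b\<close>, then \<open>x a\<close> lies
      in the translate of \<open>Q b\<close> by \<open>a\<close>, so \<open>b\<close> does not
      precede \<open>a\<close>. Hence \<open>Q b\<close> meets the range of \<open>y\<close> in
      points with index at most \<open>b\<close>.\<close>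
    have "a \<in> insert b (underS r b)" if "y a \<in> Q b" for a
    proof -
      have "x a = cadd a (y a)" by (simp add: y_def)
      then have "b \<notin> underS r a" using x(2) that by blast
      then show ?thesis
        using wo field unfolding underS_def well_order_on_def linear_order_on_def total_on_def by auto
    qed
    then have "Q b \<inter> range y \<subseteq> y ` insert b (underS r b)" by blast
    then have "|Q b \<inter> range y| \<le>o |insert b (underS r b)|"
      using card_of_mono1 card_of_image ordLeq_transitive by blast
    moreover have "below_continuum (insert b (underS r b))"
    proof -
      have "below_continuum ({b} \<union> underS r b)"
        using under[of b] below_continuum_countable[of "{b}"] uncountable_UNIV_cantor
        by (intro card_of_Un_ordLess_infinite) (auto intro: countable_finite)
      then show ?thesis by simp
    qed
    ultimately have "below_continuum (Q b \<inter> range y)" by (rule ordLeq_ordLess_trans)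
    moreover have "perfect_set (Q b)" using Q(1) \<D>(1) by (simp add: dense_family_def)
    ultimately obtain R where "perfect_set R" "R \<subseteq> Q b" "R \<inter> range y = {}"
      using avoid_below_continuum by blast
    then show "\<exists>R. perfect_set R \<and> R \<subseteq> P \<and> R \<inter> range y = {}" using Q(2) b by blast
  qed
  moreover have "setsum X (range y) = UNIV"
  proof -
    have "cadd (x a) (y a) = a" for a by (auto simp: y_def cadd_def)
    then have "a \<in> setsum X (range y)" for a
      using x(1) unfolding setsum_def by (metis (mono_tags, lifting) mem_Collect_eq rangeI)
    then show ?thesis by blast
  qed
  ultimately show ?thesis by (auto simp: shiftable_def)
qed

end
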